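(* Let $A=B^{(-1)},\ B=B^{(0)},B^{(1)},B^{(2)},\dots$ be a sequence of functions $\mathbb{N}\to Q$ (with $B^{(i)}(n)\neq0$ for all $i\ge0$, $n\in\mathbb{N}$). Put $F(\lambda)=\sum_{n\ge0}A(n)\lambda^n$ and $G(\lambda)=\sum_{n\ge0}B(n)\lambda^n$. Assume that for all $n,m,s\in\mathbb{N}$ and all $i\ge-1$: (a) $\displaystyle\frac{B^{(i)}(n+mp^{s+1})}{\varphi\big(B^{(i+1)}([\frac np]+mp^s)\big)}\equiv\frac{B^{(i)}(n)}{\varphi\big(B^{(i+1)}([\frac np])\big)}\mod[p^{s+1}]_qR$; (b) $\displaystyle\frac{B^{(i)}(n)}{\varphi\big(B^{(i+1)}([\frac np])\big)}\in R$; (c) $B^{(i)}(n)\in R$; (d) $B^{(i)}(0)\in R^\times$. Then for all $m,s\in\mathbb{N}$, $$F(\lambda)\,\varphi\Big(\sum_{j=mp^s}^{(m+1)p^s-1}B(j)\lambda^j\Big)\equiv\varphi(G(\lambda))\sum_{j=mp^{s+1}}^{(m+1)p^{s+1}-1}A(j)\lambda^j\mod[p^{s+1}]_q\,\varphi^{s+1}\big(B^{(s)}(m)\big)R[[\lambda]].$$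
   Context: $p$ is an odd prime, $q$ a formal variable, $R=\mathbb{Z}_p[[q-1]]$, $Q=\mathrm{Frac}(R)$, $\mathbb{N}=\{0,1,2,\dots\}$. $[n]_q=\frac{q^n-1}{q-1}=1+q+\cdots+q^{n-1}$ for a positive integer $n$. $[\frac np]$ (without subscript $q$) is the integer part of $n/p$. $\varphi$ is the endomorphism of $R[[\lambda]]$ with $\varphi(a)=a$ ($a\in\mathbb{Z}_p$), $\varphi(q)=q^p$, $\varphi(\lambda)=\lambda^p$ (continuous), extended to $Q$. A congruence $x\equiv y\mod I$ means $x-y\in I$. *)

theory Defs
  imports
    "HOL-Computational_Algebra.Formal_Power_Series"
    "HOL-Computational_Algebra.Polynomial_Factorial"
    "Berlekamp_Zassenhaus.Finite_Field"
begin

section \<open>The \<open>p\<close>-adic integers\<close>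

text \<open>
  The prime \<open>p\<close> is the cardinality of a type \<open>'p\<close> of class \<^class>\<open>prime_card\<close>. The \<open>p\<close>-adic
  integers are the inverse limit of the rings \<open>\<int>/p\<^sup>n\<int>\<close>: an element is a compatible sequence of
  residues, the \<open>n\<close>-th one being the representative in \<open>{0..<p\<^sup>n}\<close>. The single equation below
  expresses both the range condition and compatibility.
\<close>

typedef (overloaded) ('p :: prime_card) padic_int =
  "{f :: nat \<Rightarrow> int. \<forall>n. f (Suc n) mod int CARD('p) ^ n = f n}"
  by (rule exI[of _ "\<lambda>_. 0"]) simp

setup_lifting type_definition_padic_int

lemma mod_power_Suc_mod: "(x :: int) mod p ^ Suc n mod p ^ n = x mod p ^ n"
  by (rule mod_mod_cancel) simp

lemma padic_add_aux:
  assumes "\<And>n. f (Suc n) mod (p :: int) ^ n = f n" "\<And>n. g (Suc n) mod p ^ n = g n"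
  shows "(f (Suc n) + g (Suc n)) mod p ^ Suc n mod p ^ n = (f n + g n) mod p ^ n"
  unfolding mod_power_Suc_mod by (metis assms mod_add_eq)

lemma padic_mult_aux:
  assumes "\<And>n. f (Suc n) mod (p :: int) ^ n = f n" "\<And>n. g (Suc n) mod p ^ n = g n"
  shows "(f (Suc n) * g (Suc n)) mod p ^ Suc n mod p ^ n = (f n * g n) mod p ^ n"
  unfolding mod_power_Suc_mod by (metis assms mod_mult_eq)

lemma padic_uminus_aux:
  assumes "\<And>n. f (Suc n) mod (p :: int) ^ n = f n"
  shows "(- f (Suc n)) mod p ^ Suc n mod p ^ n = (- f n) mod p ^ n"
  unfolding mod_power_Suc_mod by (metis assms mod_minus_eq)

lemma padic_diff_aux:
  assumes "\<And>n. f (Suc n) mod (p :: int) ^ n = f n" "\<And>n. g (Suc n) mod p ^ n = g n"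
  shows "(f (Suc n) - g (Suc n)) mod p ^ Suc n mod p ^ n = (f n - g n) mod p ^ n"
  unfolding mod_power_Suc_mod by (metis assms mod_diff_eq)

lemma padic_mod_self:
  assumes "\<And>n. f (Suc n) mod (p :: int) ^ n = f n"
  shows "f n mod p ^ n = f n"
  by (metis assms mod_mod_trivial)

lemma padic_mod_le:
  assumes "\<And>n. f (Suc n) mod (p :: int) ^ n = f n"
  shows "f (n + k) mod p ^ n = f n"
proof (induction k)
  case 0
  show ?case using padic_mod_self[of f p, OF assms] by simp
next
  case (Suc k)
  have "f (n + Suc k) mod p ^ n = f (Suc (n + k)) mod p ^ (n + k) mod p ^ n"
    by (simp add: mod_mod_cancel le_imp_power_dvd)
  then show ?case using Suc assms by simp
qed

instantiation padic_int :: (prime_card) comm_ring_1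
begin

lift_definition zero_padic_int :: "'a padic_int" is "\<lambda>_. 0" by simp

lift_definition one_padic_int :: "'a padic_int" is "\<lambda>n. 1 mod int CARD('a) ^ n"
  by (rule mod_power_Suc_mod)

lift_definition plus_padic_int :: "'a padic_int \<Rightarrow> 'a padic_int \<Rightarrow> 'a padic_int"
  is "\<lambda>f g n. (f n + g n) mod int CARD('a) ^ n"
  by (rule padic_add_aux) auto

lift_definition minus_padic_int :: "'a padic_int \<Rightarrow> 'a padic_int \<Rightarrow> 'a padic_int"
  is "\<lambda>f g n. (f n - g n) mod int CARD('a) ^ n"
  by (rule padic_diff_aux) auto

lift_definition uminus_padic_int :: "'a padic_int \<Rightarrow> 'a padic_int"
  is "\<lambda>f n. (- f n) mod int CARD('a) ^ n"
  by (rule padic_uminus_aux) auto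

lift_definition times_padic_int :: "'a padic_int \<Rightarrow> 'a padic_int \<Rightarrow> 'a padic_int"
  is "\<lambda>f g n. (f n * g n) mod int CARD('a) ^ n"
  by (rule padic_mult_aux) auto

instance
proof
  fix a b c :: "'a padic_int"
  show "a * b * c = a * (b * c)"
    by transfer (simp add: mod_simps mult.assoc)
  show "a * b = b * a"
    by transfer (simp add: mult.commute)
  show "1 * a = a"
    by transfer (auto simp: fun_eq_iff mod_simps intro: padic_mod_self)
  show "a + b + c = a + (b + c)"
    by transfer (simp add: mod_simps add.assoc)
  show "a + b = b + a"
    by transfer (simp add: add.commute)
  show "0 + a = a"
    by transfer (auto simp: fun_eq_iff intro: padic_mod_self)
  show "- a + a = 0"
    by transfer (simp add: mod_simps)
  show "a - b = a + - b"
    by transfer (simp add: mod_simps)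
  show "(a + b) * c = a * c + b * c"
    by transfer (simp add: mod_simps distrib_right)
  show "(0 :: 'a padic_int) \<noteq> 1"
  proof (transfer, rule notI)
    assume "(\<lambda>_. 0) = (\<lambda>n. 1 mod int CARD('a) ^ n)"
    then have "0 = 1 mod int CARD('a) ^ 1" by (rule fun_cong)
    moreover have "int CARD('a) > 1"
      using prime_card[where ?'a = 'a] prime_gt_1_nat by force
    ultimately show False by simp
  qed
qed

end

instance padic_int :: (prime_card) idom
proof
  fix a b :: "'a padic_int"
  assume "a \<noteq> 0" "b \<noteq> 0"
  then show "a * b \<noteq> 0"
  proof (transfer, goal_cases)
    case (1 f g)
    let ?p = "int CARD('a)"
    have f: "\<And>n. f (Suc n) mod ?p ^ n = f n" and g: "\<And>n. g (Suc n) mod ?p ^ n = g n"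
      using 1 by auto
    obtain i j where i: "f i \<noteq> 0" and j: "g j \<noteq> 0"
      using 1 by (auto simp: fun_eq_iff)
    have i': "\<not> ?p ^ i dvd f (i + j)"
      using i padic_mod_le[of f ?p i j, OF f] by (auto simp: dvd_eq_mod_eq_0)
    have j': "\<not> ?p ^ j dvd g (i + j)"
      using j padic_mod_le[of g ?p j i, OF g] by (auto simp: dvd_eq_mod_eq_0 add.commute)
    have jpos: "j \<noteq> 0"
      using j' by (intro notI) simp
    have "\<not> ?p ^ (i + j) dvd f (i + j) * g (i + j)"
    proof
      assume "?p ^ (i + j) dvd f (i + j) * g (i + j)"
      moreover have "prime_elem ?p"
        using prime_card_int[where ?'a = 'a] by simp
      ultimately obtain a b where ab: "a + b = i + j" "?p ^ a dvd f (i + j)" "?p ^ b dvd g (i + j)"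
        using prime_elem_power_dvd_prod by blast
      then have "a < i" "b < j"
        using i' j' by (meson dvd_trans le_imp_power_dvd not_le)+
      with ab(1) show False by simp
    qed
    then show ?case
      by (auto simp: fun_eq_iff dvd_eq_mod_eq_0)
  qed
qed

section \<open>The ring \<open>R\<close>, its fraction field \<open>Q\<close>, and the endomorphism \<open>\<phi>\<close>\<close>

text \<open>
  \<open>R = \<int>\<^sub>p[[q - 1]]\<close> is the type of formal power series over \<open>\<int>\<^sub>p\<close>, whose indeterminate
  \<^term>\<open>fps_X\<close> plays the role of \<open>q - 1\<close>.
\<close>

type_synonym 'p q_ring = "'p padic_int fps"
type_synonym 'p q_field = "'p q_ring fract"

definition q :: "'p :: prime_card q_ring" where
  "q = 1 + fps_X"

definition q_int :: "nat \<Rightarrow> 'p :: prime_card q_ring" where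
  "q_int n = (\<Sum>i<n. q ^ i)"

lemma q_int_mult: "(q - 1) * q_int n = q ^ n - 1"
  by (simp add: q_int_def power_diff_1_eq)

text \<open>
  \<open>\<phi>\<close> is the continuous \<open>\<int>\<^sub>p\<close>-algebra endomorphism of \<open>R\<close> with \<open>\<phi>(q) = q\<^sup>p\<close>, i.e. the
  substitution \<open>q - 1 \<mapsto> q\<^sup>p - 1\<close>.
\<close>

definition phi :: "'p :: prime_card q_ring \<Rightarrow> 'p q_ring" where
  "phi f = fps_compose f (q ^ CARD('p) - 1)"

lemma q_power_minus_1_nth_0: "fps_nth (q ^ n - 1 :: 'p :: prime_card q_ring) 0 = 0"
  by (simp add: q_def fps_nth_power_0)

lemma phi_0 [simp]: "phi 0 = 0"
  and phi_1 [simp]: "phi 1 = 1"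
  and phi_add [simp]: "phi (f + g) = phi f + phi g"
  and phi_diff [simp]: "phi (f - g) = phi f - phi g"
  and phi_mult [simp]: "phi (f * g) = phi f * phi g"
  and phi_fps_const [simp]: "phi (fps_const c) = fps_const c"
  by (simp_all add: phi_def fps_compose_add_distrib fps_compose_sub_distrib
      fps_compose_mult_distrib[OF q_power_minus_1_nth_0])

lemma phi_q: "phi (q :: 'p :: prime_card q_ring) = q ^ CARD('p)"
proof -
  have "phi (q :: 'p q_ring) = 1 + phi fps_X"
    by (subst q_def) simp
  also have "phi fps_X = (q ^ CARD('p) - 1 :: 'p q_ring)"
    unfolding phi_def by (rule fps_X_fps_compose_startby0) (rule q_power_minus_1_nth_0)
  finally show ?thesis by simp
qed

lemma q_power_nth: "fps_nth (q ^ n :: 'p :: prime_card q_ring) k = of_nat (n choose k)"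
proof (induction n arbitrary: k)
  case 0
  show ?case by (cases k) simp_all
next
  case (Suc n)
  then show ?case
    by (cases k) (simp_all add: q_def distrib_right fps_X_mult_nth add.commute)
qed

lemma phi_eq_0_iff [simp]: "phi (f :: 'p :: prime_card q_ring) = 0 \<longleftrightarrow> f = 0"
proof -
  have "CARD('p) \<noteq> 0"
    using prime_card[where ?'a = 'p] by (metis not_prime_0)
  then have "fps_nth (q ^ CARD('p) - 1 :: 'p q_ring) CARD('p) = 1"
    by (simp add: q_power_nth)
  then have "(q ^ CARD('p) - 1 :: 'p q_ring) \<noteq> 0"
    by (metis fps_zero_nth zero_neq_one)
  then show ?thesis
    unfolding phi_def by (subst fps_compose_eq_0_iff[OF q_power_minus_1_nth_0]) simp
qed

text \<open>
  The extension of \<open>\<phi>\<close> to \<open>Q\<close>; it is well defined because \<open>\<phi>\<close> is injective on \<open>R\<close>.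
\<close>

definition phi_fract :: "'p :: prime_card q_field \<Rightarrow> 'p q_field" where
  "phi_fract x = (THE y. \<exists>a b. b \<noteq> 0 \<and> x = Fract a b \<and> y = Fract (phi a) (phi b))"

lemma phi_fract_Fract:
  assumes "b \<noteq> 0"
  shows "phi_fract (Fract a b) = Fract (phi a) (phi b)"
  unfolding phi_fract_def
proof (rule the_equality)
  show "\<exists>a' b'. b' \<noteq> 0 \<and> Fract a b = Fract a' b' \<and> Fract (phi a) (phi b) = Fract (phi a') (phi b')"
    using assms by blast
next
  fix y
  assume "\<exists>a' b'. b' \<noteq> 0 \<and> Fract a b = Fract a' b' \<and> y = Fract (phi a') (phi b')"
  then obtain a' b' where *: "b' \<noteq> 0" "Fract a b = Fract a' b'" "y = Fract (phi a') (phi b')"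
    by blast
  then have "a * b' = a' * b"
    using assms by (simp add: eq_fract)
  then have "phi a * phi b' = phi a' * phi b"
    by (metis phi_mult)
  then show "y = Fract (phi a) (phi b)"
    using * assms by (simp add: eq_fract)
qed

lemma phi_fract_to_fract [simp]: "phi_fract (to_fract a) = to_fract (phi a)"
  by (simp add: to_fract_def phi_fract_Fract)

text \<open>
  The extension to power series in \<open>\<lambda>\<close>: apply \<open>\<phi>\<close> to the coefficients and substitute
  \<open>\<lambda> \<mapsto> \<lambda>\<^sup>p\<close>.
\<close>

definition phi_series :: "'p :: prime_card q_field fps \<Rightarrow> 'p q_field fps" where
  "phi_series F = fps_compose (Abs_fps (\<lambda>n. phi_fract (fps_nth F n))) (fps_X ^ CARD('p))"

section \<open>Subsets of \<open>Q\<close> and \<open>Q[[\<lambda>]]\<close>\<close>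

text \<open>\<open>R\<close> and \<open>R[[\<lambda>]]\<close> as subrings of \<open>Q\<close> and \<open>Q[[\<lambda>]]\<close>, and the group of units of \<open>R\<close>.\<close>

definition R_set :: "'p :: prime_card q_field set" where
  "R_set = range to_fract"

definition R_units :: "'p :: prime_card q_field set" where
  "R_units = to_fract ` {u. u dvd 1}"

definition R_series :: "'p :: prime_card q_field fps set" where
  "R_series = {f. \<forall>n. fps_nth f n \<in> R_set}"

text \<open>The principal submodules \<open>c R\<close> and \<open>c R[[\<lambda>]]\<close> for \<open>c \<in> Q\<close>.\<close>

definition R_multiples :: "'p :: prime_card q_field \<Rightarrow> 'p q_field set" where
  "R_multiples c = (\<lambda>r. c * r) ` R_set"

definition R_series_multiples :: "'p :: prime_card q_field \<Rightarrow> 'p q_field fps set" where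
  "R_series_multiples c = (\<lambda>f. fps_const c * f) ` R_series"

end

theory Submission
  imports Defs
begin

text \<open>
  The proof is Dwork's, with \<open>p\<^sup>s\<close> replaced by \<open>[p\<^sup>s]\<^sub>q\<close>. Compare coefficients at an exponent
  \<open>a + p * N\<close> with \<open>a < p\<close>. The difference of the two sides has there, as its coefficient, the sum over the \<open>m\<close>-th block
  \<open>mp\<^sup>s \<le> j < (m+1)p\<^sup>s\<close>, of the cross terms
  \<open>A(a + p(N - j)) \<cdot> \<phi>(B(j)) - \<phi>(B(N - j)) \<cdot> A(a + pj)\<close>,
  and this block sum must be shown to be divisible by \<open>[p\<^sup>s\<^sup>+\<^sup>1]\<^sub>q \<phi>\<^sup>s\<^sup>+\<^sup>1(B\<^sup>(\<^sup>s\<^sup>)(m))\<close>.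

  Two facts work together. First, the cross term changes sign under \<open>j \<mapsto> N - j\<close> and is \<open>0\<close> for \<open>j > N\<close>, so the sum over
  all blocks vanishes (\<open>sum_cross_terms_eq_0\<close>). Secondly, the block sum of block \<open>m\<close> at
  \<open>N + mp\<^sup>s\<close> is congruent, for the desired modulus, to
  \<open>\<phi>\<^sup>s\<^sup>+\<^sup>1(B\<^sup>(\<^sup>s\<^sup>)(m)) / \<phi>\<^sup>s\<^sup>+\<^sup>1(B\<^sup>(\<^sup>s\<^sup>)(0))\<close> times the block sum of block \<open>0\<close> at \<open>N\<close> (the case \<open>t = s\<close> of
  \<open>block_sum_shift\<close>). The second fact is obtained by starting with blocks of length \<open>1\<close> and merging
  \<open>p\<close> neighbouring blocks at a time: each merger costs an error divisible by \<open>\<phi>\<^sup>t\<^sup>+\<^sup>1([p\<^sup>s\<^sup>-\<^sup>t]\<^sub>q)\<close>, times block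
  sums of level \<open>t < s\<close>, which are divisible by \<open>[p\<^sup>t\<^sup>+\<^sup>1]\<^sub>q\<close> by induction; the product of the two is
  \<open>[p\<^sup>s\<^sup>+\<^sup>1]\<^sub>q\<close>.

  Given both facts, an induction on \<open>N\<close> shows that block \<open>0\<close> has a block sum divisible by
  \<open>[p\<^sup>s\<^sup>+\<^sup>1]\<^sub>q\<close>: it is minus the sum of those of the blocks \<open>m \<ge> 1\<close>, and these are controlled by block \<open>0\<close>
  at the smaller values \<open>N - mp\<^sup>s\<close>, or are \<open>0\<close> if \<open>N < mp\<^sup>s\<close>. Since \<open>B\<^sup>(\<^sup>s\<^sup>)(0)\<close> is a unit, the second fact extends the
  divisibility to all blocks (\<open>block_sum_in_multiples\<close>).
\<close>

section \<open>Congruences between block sums of cross terms\<close>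

text \<open>
  The endomorphism \<open>\<phi>\<close> enters the argument only through its iterates, so it can be hidden:
  \<open>W t n\<close> stands for \<open>\<phi>\<^sup>t(B\<^sup>(\<^sup>t\<^sup>-\<^sup>1\<^sup>)(n))\<close> and \<open>modulus t s\<close> for \<open>\<phi>\<^sup>t([p\<^sup>s]\<^sub>q)\<close>. The hypothesis
  \<open>modulus_mult\<close> is then \<open>[p\<^sup>t]\<^sub>q \<cdot> \<phi>\<^sup>t([p\<^sup>s]\<^sub>q) = [p\<^sup>t\<^sup>+\<^sup>s]\<^sub>q\<close>; with \<open>modulus t s = p\<^sup>s\<close> the system describes
  Dwork's classical situation over \<open>\<int>\<^sub>p\<close>. The index \<open>t = 0\<close> belongs to the sequence \<open>A\<close>, some
  of whose values may vanish.
\<close>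

locale dwork_system =
  fixes R :: "'a :: field set" and p :: nat and W modulus :: "nat \<Rightarrow> nat \<Rightarrow> 'a"
  assumes p_pos: "0 < p"
    and R_1: "1 \<in> R"
    and R_diff: "x \<in> R \<Longrightarrow> y \<in> R \<Longrightarrow> x - y \<in> R"
    and R_mult: "x \<in> R \<Longrightarrow> y \<in> R \<Longrightarrow> x * y \<in> R"
    and W_nonzero: "W (Suc t) n \<noteq> 0"
    and W_in_R: "W t n \<in> R"
    and W_0_unit: "inverse (W t 0) \<in> R"
    and W_ratio: "W t n / W (Suc t) (n div p) \<in> R"
    and W_cong: "W t (n + m * p ^ Suc s) / W (Suc t) (n div p + m * p ^ s)
                   - W t n / W (Suc t) (n div p) \<in> (*) (modulus t (Suc s)) ` R"
    and modulus_mult: "modulus 0 t * modulus t s = modulus 0 (t + s)"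
begin

abbreviation multiples :: "'a \<Rightarrow> 'a set" where
  "multiples x \<equiv> (*) x ` R"

lemma R_0: "0 \<in> R"
  using R_diff[OF R_1 R_1] by simp

lemma R_add: "x \<in> R \<Longrightarrow> y \<in> R \<Longrightarrow> x + y \<in> R"
  using R_diff[of x "0 - y"] R_diff[OF R_0, of y] by simp

lemma multiples_0: "0 \<in> multiples x"
  using R_0 by force

lemma multiples_add: "y \<in> multiples x \<Longrightarrow> z \<in> multiples x \<Longrightarrow> y + z \<in> multiples x"
  by (auto simp: distrib_left[symmetric] intro!: imageI R_add)

lemma multiples_diff: "y \<in> multiples x \<Longrightarrow> z \<in> multiples x \<Longrightarrow> y - z \<in> multiples x"
  by (auto simp: right_diff_distrib[symmetric] intro!: imageI R_diff)

lemma multiples_diff_trans: "x - y \<in> multiples c \<Longrightarrow> y - z \<in> multiples c \<Longrightarrow> x - z \<in> multiples c"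
  using multiples_add[of "x - y" c "y - z"] by simp

lemma multiples_sum: "(\<And>i. i \<in> I \<Longrightarrow> f i \<in> multiples x) \<Longrightarrow> sum f I \<in> multiples x"
  by (induction I rule: infinite_finite_induct) (simp_all add: multiples_0 multiples_add)

lemma multiples_mult: "y \<in> multiples x \<Longrightarrow> y' \<in> multiples x' \<Longrightarrow> y * y' \<in> multiples (x * x')"
  by (auto simp: mult_ac image_iff) (metis R_mult mult.left_commute)

lemma multiples_scale: "y \<in> multiples x \<Longrightarrow> r \<in> R \<Longrightarrow> y * r \<in> multiples x"
  by (auto simp: mult.assoc intro!: imageI R_mult)

lemma multiples_trans: "y \<in> multiples x \<Longrightarrow> x \<in> multiples z \<Longrightarrow> y \<in> multiples z"
  by (auto simp: mult.assoc intro!: imageI R_mult)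

lemma multiples_self: "x \<in> multiples x"
  using R_1 by force

lemma W_multiple_iterated: "W t n \<in> multiples (W (t + k) (n div p ^ k))"
proof (induction k)
  case 0
  show ?case by (simp add: multiples_self)
next
  case (Suc k)
  have "W (t + k) (n div p ^ k)
      = W (t + Suc k) (n div p ^ Suc k) * (W (t + k) (n div p ^ k) / W (t + Suc k) (n div p ^ Suc k))"
    using W_nonzero by simp
  moreover have "W (t + k) (n div p ^ k) / W (t + Suc k) (n div p ^ Suc k) \<in> R"
    using W_ratio[of "t + k" "n div p ^ k"] by (simp add: div_mult2_eq[symmetric] mult.commute)
  ultimately have "W (t + k) (n div p ^ k) \<in> multiples (W (t + Suc k) (n div p ^ Suc k))"
    by (metis imageI)
  with Suc show ?case by (rule multiples_trans)
qed

text \<open>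
  All indices in the \<open>m\<close>-th block of length \<open>p\<^sup>k\<close> have the same \<open>k\<close>-fold quotient \<open>m\<close>. This is
  how the factor \<open>W (Suc s) m\<close> gets into the final modulus.
\<close>

lemma W_block_multiple:
  assumes "j < p ^ k"
  shows "W t (j + m * p ^ k) \<in> multiples (W (t + k) m)"
  using W_multiple_iterated[of t "j + m * p ^ k" k] assms p_pos by (simp add: div_add1_eq)

text \<open>
  At the exponent \<open>a + p * N\<close> of \<open>\<lambda>\<close>, with \<open>a < p\<close>, the first product is the contribution of
  \<open>\<phi>(B(j))\<close> to \<open>F \<cdot> \<phi>(G)\<close> and the second one that of \<open>A(a + p * j)\<close> to \<open>\<phi>(G) \<cdot> F\<close>. Indices
  beyond \<open>N\<close> contribute nothing; without the guard, the truncated difference \<open>N - j = 0\<close> would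
  let them do so.
\<close>

definition cross_term :: "nat \<Rightarrow> nat \<Rightarrow> nat \<Rightarrow> 'a" where
  "cross_term a N j = (if j \<le> N then W 0 (a + p * (N - j)) * W 1 j - W 1 (N - j) * W 0 (a + p * j) else 0)"

definition block_sum :: "nat \<Rightarrow> nat \<Rightarrow> nat \<Rightarrow> nat \<Rightarrow> 'a" where
  "block_sum a N s m = sum (cross_term a N) {m * p ^ s..<m * p ^ s + p ^ s}"

text \<open>
  The two products \<open>F \<cdot> \<phi>(G)\<close> and \<open>\<phi>(G) \<cdot> F\<close> agree: the reflection \<open>j \<mapsto> N - j\<close> changes the sign of
  the cross term.
\<close>

lemma sum_cross_terms_eq_0:
  assumes "N < M"
  shows "sum (cross_term a N) {..<M} = 0"
proof -
  have "sum (cross_term a N) {..<M} = sum (cross_term a N) {..N}"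
    using assms by (intro sum.mono_neutral_right) (auto simp: cross_term_def)
  also have "\<dots> = (\<Sum>j\<le>N. W 0 (a + p * (N - j)) * W 1 j) - (\<Sum>j\<le>N. W 1 (N - j) * W 0 (a + p * j))"
    by (simp add: cross_term_def sum_subtractf)
  also have "(\<Sum>j\<le>N. W 1 (N - j) * W 0 (a + p * j)) = (\<Sum>j\<le>N. W 0 (a + p * (N - j)) * W 1 j)"
    by (rule sum.reindex_bij_witness[of _ "\<lambda>j. N - j" "\<lambda>j. N - j"]) auto
  finally show ?thesis by simp
qed

lemma sum_block_sums: "(\<Sum>m<M. block_sum a N s m) = sum (cross_term a N) {..<M * p ^ s}"
  unfolding block_sum_def by (rule sum.nat_group)

lemma block_sum_Suc: "block_sum a N (Suc s) m = sum (block_sum a N s) {m * p..<m * p + p}"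
proof -
  have interval: "sum g {k..<k + l} = sum g {..<k + l} - sum g {..<k}" for g :: "nat \<Rightarrow> 'a" and k l
    using sum_diff_nat_ivl[of 0 k "k + l" g] by (simp add: atLeast0LessThan)
  have eq: "m * p ^ Suc s = (m * p) * p ^ s" "m * p ^ Suc s + p ^ Suc s = (m * p + p) * p ^ s"
    by (simp_all add: algebra_simps)
  show ?thesis
    unfolding block_sum_def[of a N "Suc s"] interval sum_block_sums by (simp only: eq(2)) (simp only: eq(1))
qed

lemma block_sum_eq_0: "N < m * p ^ s \<Longrightarrow> block_sum a N s m = 0"
  by (auto simp: block_sum_def cross_term_def intro!: sum.neutral)

text \<open>
  Translating \<open>N\<close> and all indices by the multiple \<open>m * p ^ s\<close> of \<open>p ^ s\<close> leaves the differences
  \<open>N - j\<close> alone. In the two factors that do move, the congruence hypothesis replaces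
  \<open>W 0 (a + p * j + m * p ^ Suc s)\<close> by \<open>W 0 (a + p * j)\<close> times the ratio
  \<open>W 1 (j + m * p ^ s) / W 1 j\<close>, with an error divisible by the product of \<open>modulus 0 (Suc s)\<close> and
  \<open>W 1 (j + m * p ^ s)\<close>; this turns the whole cross term into that ratio times the
  untranslated one.
\<close>

lemma block_sum_shift_base:
  assumes "a < p"
  shows "block_sum a (N + m * p ^ s) s m
    - (\<Sum>j<p ^ s. W 1 (j + m * p ^ s) / W 1 j * block_sum a N 0 j) \<in> multiples (modulus 0 (Suc s) * W (Suc s) m)"
proof -
  let ?K = "m * p ^ s"
  have "block_sum a (N + ?K) s m = (\<Sum>j<p ^ s. cross_term a (N + ?K) (j + ?K))"
    using sum.shift_bounds_nat_ivl[of "cross_term a (N + ?K)" 0 ?K "p ^ s"]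
    by (simp add: block_sum_def lessThan_atLeast0 add.commute)
  moreover have "block_sum a N 0 j = cross_term a N j" for j
    by (simp add: block_sum_def)
  ultimately have eq: "block_sum a (N + ?K) s m - (\<Sum>j<p ^ s. W 1 (j + ?K) / W 1 j * block_sum a N 0 j)
      = (\<Sum>j<p ^ s. cross_term a (N + ?K) (j + ?K) - W 1 (j + ?K) / W 1 j * cross_term a N j)"
    by (simp add: sum_subtractf)
  show ?thesis
    unfolding eq
  proof (rule multiples_sum)
    fix j assume "j \<in> {..<p ^ s}"
    then have j: "j < p ^ s" by simp
    show "cross_term a (N + ?K) (j + ?K) - W 1 (j + ?K) / W 1 j * cross_term a N j
        \<in> multiples (modulus 0 (Suc s) * W (Suc s) m)"
    proof (cases "j \<le> N")
      case False
      then show ?thesis by (simp add: cross_term_def multiples_0)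
    next
      case True
      define x where "x = W 0 (a + p * j + m * p ^ Suc s) / W 1 (j + ?K) - W 0 (a + p * j) / W 1 j"
      have x: "x \<in> multiples (modulus 0 (Suc s))"
        using W_cong[of 0 "a + p * j" m s] assms by (simp add: x_def)
      have nz: "W 1 n \<noteq> 0" for n
        using W_nonzero[of 0] by simp
      have *: "cross_term a (N + ?K) (j + ?K)
          = W 0 (a + p * (N - j)) * W 1 (j + ?K) - W 1 (N - j) * W 0 (a + p * j + m * p ^ Suc s)"
        using True by (simp add: cross_term_def algebra_simps)
      have **: "W 0 (a + p * j + m * p ^ Suc s) = W 1 (j + ?K) * (x + W 0 (a + p * j) / W 1 j)"
        using nz by (simp add: x_def)
      have "u * w - v * (w * (x + z / b)) - w / b * (u * b - v * z) = 0 - x * w * v"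
        if "b \<noteq> 0" for u v w z b :: 'a
        using that by (simp add: field_simps)
      \<comment> \<open>The letters stand for \<open>W 0 (a + p * (N - j))\<close>, \<open>W 1 (N - j)\<close>, \<open>W 1 (j + ?K)\<close>, \<open>W 0 (a + p * j)\<close>, \<open>W 1 j\<close>.\<close>
      from this[OF nz] have "cross_term a (N + ?K) (j + ?K) - W 1 (j + ?K) / W 1 j * cross_term a N j
          = 0 - x * W 1 (j + ?K) * W 1 (N - j)"
        unfolding * ** using True by (simp only: cross_term_def if_True)
      moreover have "W 1 (j + ?K) \<in> multiples (W (Suc s) m)"
        using W_block_multiple[OF j, of 1 m] by simp
      ultimately show ?thesis
        by (simp only:) (intro multiples_diff multiples_0 multiples_scale multiples_mult x W_in_R)
    qed
  qed
qed

text \<open>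
  By the congruence hypothesis, the coefficients of the block sums can be exchanged for coefficients that depend only on the
  block \<open>\<mu> = j div p\<close>, so that \<open>p\<close> block sums of level \<open>t\<close> merge into one of level \<open>Suc t\<close>. The error
  of the exchange is a multiple of \<open>modulus (Suc t) (Suc k)\<close>, and the block sum that it multiplies
  supplies the complementary factor \<open>modulus 0 (Suc t)\<close> as well as the denominator
  \<open>W (Suc t) j\<close>.
\<close>

lemma block_sum_shift_step:
  assumes small: "\<And>j. block_sum a N t j \<in> multiples (modulus 0 (Suc t) * W (Suc t) j)"
    and s: "s = Suc t + k"
  shows "(\<Sum>j<p ^ Suc k. W (Suc t) (j + m * p ^ Suc k) / W (Suc t) j * block_sum a N t j)
       - (\<Sum>\<mu><p ^ k. W (Suc (Suc t)) (\<mu> + m * p ^ k) / W (Suc (Suc t)) \<mu> * block_sum a N (Suc t) \<mu>)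
       \<in> multiples (modulus 0 (Suc s) * W (Suc s) m)"
proof -
  let ?V = "W (Suc (Suc t))"
  let ?f = "\<lambda>j. W (Suc t) (j + m * p ^ Suc k) / W (Suc t) j * block_sum a N t j"
  let ?g = "\<lambda>\<mu>. ?V (\<mu> + m * p ^ k) / ?V \<mu>"
  have "(\<Sum>j<p ^ Suc k. ?f j) = (\<Sum>\<mu><p ^ k. sum ?f {\<mu> * p..<\<mu> * p + p})"
    by (simp add: sum.nat_group mult.commute)
  then have eq: "(\<Sum>j<p ^ Suc k. ?f j) - (\<Sum>\<mu><p ^ k. ?g \<mu> * block_sum a N (Suc t) \<mu>)
      = (\<Sum>\<mu><p ^ k. \<Sum>j=\<mu> * p..<\<mu> * p + p. ?f j - ?g \<mu> * block_sum a N t j)"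
    by (simp add: block_sum_Suc sum_subtractf sum_distrib_left)
  show ?thesis
    unfolding eq
  proof (intro multiples_sum)
    fix \<mu> j assume "\<mu> \<in> {..<p ^ k}" and j: "j \<in> {\<mu> * p..<\<mu> * p + p}"
    then have \<mu>: "\<mu> < p ^ k" by simp
    have div: "j div p = \<mu>"
      using j by (intro div_nat_eqI) (auto simp: algebra_simps)
    define x where "x = W (Suc t) (j + m * p ^ Suc k) / ?V (\<mu> + m * p ^ k) - W (Suc t) j / ?V \<mu>"
    have x: "x \<in> multiples (modulus (Suc t) (Suc k))"
      using W_cong[of "Suc t" j m k] div by (simp add: x_def)
    obtain r where r: "r \<in> R" "block_sum a N t j = modulus 0 (Suc t) * W (Suc t) j * r"
      using small[of j] by auto
    have y: "W (Suc t) (j + m * p ^ Suc k) = ?V (\<mu> + m * p ^ k) * (x + W (Suc t) j / ?V \<mu>)"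
      using W_nonzero by (simp add: x_def)
    have "v * (x + b / c) / b * (e * b * r) - v / c * (e * b * r) = e * x * v * r"
      if "b \<noteq> 0" "c \<noteq> 0" for v b c e :: 'a
      using that by (simp add: field_simps)
    from this[OF W_nonzero W_nonzero]
    have f: "?f j - ?g \<mu> * block_sum a N t j = modulus 0 (Suc t) * x * ?V (\<mu> + m * p ^ k) * r"
      unfolding y r(2) .
    have V: "?V (\<mu> + m * p ^ k) \<in> multiples (W (Suc s) m)"
      using W_block_multiple[OF \<mu>, of "Suc (Suc t)" m] by (simp add: s)
    have "modulus 0 (Suc t) * x \<in> multiples (modulus 0 (Suc t) * modulus (Suc t) (Suc k))"
      by (rule multiples_mult[OF multiples_self x])
    then have "modulus 0 (Suc t) * x \<in> multiples (modulus 0 (Suc s))"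
      by (simp add: s modulus_mult)
    then show "?f j - ?g \<mu> * block_sum a N t j \<in> multiples (modulus 0 (Suc s) * W (Suc s) m)"
      unfolding f by (intro multiples_scale[OF multiples_mult] V r(1))
  qed
qed

text \<open>
  For \<open>t = s\<close> the subtracted sum has the single term \<open>j = 0\<close>, which compares the block sum of
  block \<open>m\<close> at \<open>N + m * p ^ s\<close> with that of block \<open>0\<close> at \<open>N\<close>.
\<close>

lemma block_sum_shift:
  assumes "a < p"
    and small: "\<And>t j. t < s \<Longrightarrow> block_sum a N t j \<in> multiples (modulus 0 (Suc t) * W (Suc t) j)"
    and "t \<le> s"
  shows "block_sum a (N + m * p ^ s) s m
    - (\<Sum>j<p ^ (s - t). W (Suc t) (j + m * p ^ (s - t)) / W (Suc t) j * block_sum a N t j)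
    \<in> multiples (modulus 0 (Suc s) * W (Suc s) m)"
  using \<open>t \<le> s\<close>
proof (induction t)
  case 0
  show ?case using block_sum_shift_base[OF \<open>a < p\<close>] by simp
next
  case (Suc t)
  define k where "k = s - Suc t"
  have k: "s - t = Suc k" "s - Suc t = k" "s = Suc t + k"
    using Suc.prems by (auto simp: k_def)
  have IH: "block_sum a (N + m * p ^ s) s m
      - (\<Sum>j<p ^ Suc k. W (Suc t) (j + m * p ^ Suc k) / W (Suc t) j * block_sum a N t j)
      \<in> multiples (modulus 0 (Suc s) * W (Suc s) m)"
    using Suc.IH[OF Suc_leD[OF Suc.prems]] unfolding k(1) .
  have "block_sum a N t j \<in> multiples (modulus 0 (Suc t) * W (Suc t) j)" for j
    using small Suc.prems by simp
  from multiples_diff_trans[OF IH block_sum_shift_step[OF this k(3)]] show ?case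
    unfolding k(2) .
qed

text \<open>
  Once the levels below \<open>s\<close> are known, \<open>block_sum_shift\<close> reduces level \<open>s\<close> to block \<open>0\<close>. For that
  block an inner induction on \<open>N\<close> suffices: all block sums add up to \<open>0\<close>, and each block sum other
  than that of block \<open>0\<close> either vanishes, its indices lying beyond \<open>N\<close>, or is governed by block \<open>0\<close> at a smaller value of \<open>N\<close>.
\<close>

theorem block_sum_in_multiples:
  assumes "a < p"
  shows "block_sum a N s m \<in> multiples (modulus 0 (Suc s) * W (Suc s) m)"
proof (induction s arbitrary: N m rule: less_induct)
  case (less s)
  let ?D = "modulus 0 (Suc s)" and ?W = "W (Suc s)"
  have shift: "block_sum a (N + m * p ^ s) s m \<in> multiples (?D * ?W m)"
    if zero: "block_sum a N s 0 \<in> multiples ?D" for N m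
  proof -
    have "block_sum a (N + m * p ^ s) s m - ?W m / ?W 0 * block_sum a N s 0 \<in> multiples (?D * ?W m)"
      using block_sum_shift[OF assms less, of s s N m] by simp
    moreover have "block_sum a N s 0 * ?W m * inverse (?W 0) \<in> multiples (?D * ?W m)"
      by (rule multiples_scale[OF multiples_mult[OF zero multiples_self] W_0_unit])
    ultimately have "(block_sum a (N + m * p ^ s) s m - ?W m / ?W 0 * block_sum a N s 0)
        + block_sum a N s 0 * ?W m * inverse (?W 0) \<in> multiples (?D * ?W m)"
      by (rule multiples_add)
    then show ?thesis by (simp add: divide_inverse mult_ac)
  qed
  have zero: "block_sum a N s 0 \<in> multiples ?D" for N
  proof (induction N rule: less_induct)
    case (less N)
    have "N < Suc N * p ^ s"
      using p_pos mult_le_mono2[of 1 "p ^ s" "Suc N"] by simp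
    then have "(\<Sum>m<Suc N. block_sum a N s m) = 0"
      unfolding sum_block_sums by (rule sum_cross_terms_eq_0)
    then have "block_sum a N s 0 = 0 - (\<Sum>m<N. block_sum a N s (Suc m))"
      by (simp only: sum.lessThan_Suc_shift) (simp add: eq_neg_iff_add_eq_0)
    moreover have "block_sum a N s (Suc m) \<in> multiples ?D" for m
    proof (cases "Suc m * p ^ s \<le> N")
      case False
      then show ?thesis using block_sum_eq_0 multiples_0 by simp
    next
      case True
      define M where "M = N - Suc m * p ^ s"
      have M: "N = M + Suc m * p ^ s"
        using True unfolding M_def by (rule le_add_diff_inverse2[symmetric])
      have "M < N"
        unfolding M using p_pos by simp
      note less_M = less.IH[OF this]
      have "block_sum a N s (Suc m) \<in> multiples (?D * ?W (Suc m))"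
        unfolding M by (intro shift less_M)
      moreover have "?D * ?W (Suc m) \<in> multiples ?D"
        by (rule multiples_scale[OF multiples_self W_in_R])
      ultimately show ?thesis by (rule multiples_trans)
    qed
    ultimately show ?case
      by (simp only:) (intro multiples_diff multiples_0 multiples_sum)
  qed
  show ?case
  proof (cases "m * p ^ s \<le> N")
    case False
    then show ?thesis using block_sum_eq_0 multiples_0 by simp
  next
    case True
    then show ?thesis using shift[OF zero, of "N - m * p ^ s" m] by simp
  qed
qed

end

section \<open>The endomorphism \<open>\<phi>\<close> and the \<open>q\<close>-integers\<close>

lemma phi_q_power: "phi (q ^ n :: 'p :: prime_card q_ring) = q ^ (CARD('p) * n)"
  by (induction n) (simp_all add: phi_q power_add)

lemma phi_sum: "phi (sum f I) = (\<Sum>i\<in>I. phi (f i))"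
  by (induction I rule: infinite_finite_induct) simp_all

lemma phi_funpow_q_int:
  "(phi ^^ t) (q_int n :: 'p :: prime_card q_ring) = (\<Sum>i<n. (q ^ CARD('p) ^ t) ^ i)"
  by (induction t) (simp_all add: q_int_def phi_sum phi_q_power power_mult[symmetric] mult.assoc)

text \<open>
  After multiplication by \<open>q - 1\<close>, which is not a zero divisor, the product telescopes, since
  \<open>(q\<^sup>n - 1) \<cdot> \<phi>\<^sup>t([k]\<^sub>q) = q\<^sup>n\<^sup>k - 1\<close> for \<open>n = p\<^sup>t\<close>.
\<close>

lemma q_int_prime_power_mult:
  "q_int (CARD('p) ^ t) * (phi ^^ t) (q_int (CARD('p) ^ s))
     = (q_int (CARD('p) ^ (t + s)) :: 'p :: prime_card q_ring)"
proof -
  have "(q - 1 :: 'p q_ring) * (q_int (CARD('p) ^ t) * (phi ^^ t) (q_int (CARD('p) ^ s)))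
      = (q ^ CARD('p) ^ t - 1) * (\<Sum>i<CARD('p) ^ s. (q ^ CARD('p) ^ t) ^ i)"
    by (simp only: mult.assoc[symmetric] q_int_mult phi_funpow_q_int)
  also have "\<dots> = (q ^ CARD('p) ^ t) ^ CARD('p) ^ s - 1"
    by (rule power_diff_1_eq[symmetric])
  also have "\<dots> = (q - 1) * q_int (CARD('p) ^ (t + s))"
    by (simp only: q_int_mult power_add power_mult)
  finally show ?thesis
    by (simp add: q_def)
qed

lemma phi_fract_add: "phi_fract (x + y) = phi_fract x + phi_fract y"
  by (cases x rule: Fract_cases; cases y rule: Fract_cases) (simp add: phi_fract_Fract)

lemma phi_fract_mult: "phi_fract (x * y) = phi_fract x * phi_fract y"
  by (cases x rule: Fract_cases; cases y rule: Fract_cases) (simp add: phi_fract_Fract)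

lemma phi_fract_0 [simp]: "phi_fract 0 = 0" and phi_fract_1 [simp]: "phi_fract 1 = 1"
  using phi_fract_to_fract[of 0] phi_fract_to_fract[of 1] by simp_all

lemma phi_fract_diff: "phi_fract (x - y) = phi_fract x - phi_fract y"
  using phi_fract_add[of "x - y" y] by simp

lemma phi_fract_inverse: "phi_fract (inverse x) = inverse (phi_fract x)"
proof (cases "x = 0")
  case False
  then have "phi_fract x * phi_fract (inverse x) = 1"
    by (simp flip: phi_fract_mult)
  then show ?thesis by (metis inverse_unique)
qed simp

lemma phi_fract_eq_0_iff: "phi_fract x = 0 \<longleftrightarrow> x = 0"
  by (cases x rule: Fract_cases) (simp add: phi_fract_Fract fract_expand eq_fract)

lemma phi_fract_funpow:
  "(phi_fract ^^ t) 0 = 0"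
  "(phi_fract ^^ t) (x - y) = (phi_fract ^^ t) x - (phi_fract ^^ t) y"
  "(phi_fract ^^ t) (x * y) = (phi_fract ^^ t) x * (phi_fract ^^ t) y"
  "(phi_fract ^^ t) (inverse x) = inverse ((phi_fract ^^ t) x)"
  "(phi_fract ^^ t) (x / y) = (phi_fract ^^ t) x / (phi_fract ^^ t) y"
  "(phi_fract ^^ t) x = 0 \<longleftrightarrow> x = 0"
  "(phi_fract ^^ t) (to_fract r) = to_fract ((phi ^^ t) r)"
  by (induction t)
    (simp_all add: phi_fract_diff phi_fract_mult phi_fract_inverse phi_fract_eq_0_iff divide_inverse)

lemma R_set_funpow: "x \<in> R_set \<Longrightarrow> (phi_fract ^^ t) x \<in> R_set"
  by (auto simp: R_set_def phi_fract_funpow)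

lemma R_units_inverse: "x \<in> R_units \<Longrightarrow> inverse x \<in> R_set"
proof -
  assume "x \<in> R_units"
  then obtain u v where "x = to_fract u" "1 = u * v"
    by (auto simp: R_units_def dvd_def)
  then have "x * to_fract v = 1"
    by (metis to_fract_1 to_fract_mult)
  then show ?thesis
    by (metis R_set_def inverse_unique rangeI)
qed

lemma R_multiples_funpow:
  "x \<in> R_multiples c \<Longrightarrow> (phi_fract ^^ t) x \<in> R_multiples ((phi_fract ^^ t) c)"
  by (auto simp: R_multiples_def phi_fract_funpow(3) intro!: imageI R_set_funpow)

lemma R_set_closed:
  "1 \<in> R_set"
  "x \<in> R_set \<Longrightarrow> y \<in> R_set \<Longrightarrow> x - y \<in> R_set"
  "x \<in> R_set \<Longrightarrow> y \<in> R_set \<Longrightarrow> x * y \<in> R_set"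
  by (auto simp: R_set_def simp flip: to_fract_1 to_fract_diff to_fract_mult)

section \<open>Coefficients of power series in \<open>\<lambda>\<close>\<close>

lemma phi_series_nth:
  fixes f :: "'p :: prime_card q_field fps"
  shows "fps_nth (phi_series f) n = (if CARD('p) dvd n then phi_fract (fps_nth f (n div CARD('p))) else 0)"
proof -
  have "fps_nth (phi_series f) n
      = (\<Sum>i=0..n. if n = CARD('p) * i then phi_fract (fps_nth f i) else 0)"
    unfolding phi_series_def fps_compose_nth power_mult[symmetric] fps_X_power_nth
    by (intro sum.cong) auto
  also have "\<dots> = (if CARD('p) dvd n then phi_fract (fps_nth f (n div CARD('p))) else 0)"
  proof (cases "CARD('p) dvd n")
    case True
    then have "n = CARD('p) * i \<longleftrightarrow> i = n div CARD('p)" for i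
      by auto
    then show ?thesis using True by simp
  qed (auto intro!: sum.neutral)
  finally show ?thesis .
qed

lemma coeff_mult_phi_series_sum:
  fixes f :: "'p :: prime_card q_field fps"
  assumes p: "p = CARD('p)" and "a < p" and "finite J"
  shows "fps_nth (f * phi_series (\<Sum>j\<in>J. fps_const (b j) * fps_X ^ j)) (a + p * N)
    = (\<Sum>j\<in>J. if j \<le> N then fps_nth f (a + p * (N - j)) * phi_fract (b j) else 0)"
proof -
  have coeff: "fps_nth (\<Sum>j\<in>J. fps_const (b j) * fps_X ^ j) n = (if n \<in> J then b n else 0)" for n
    using \<open>finite J\<close> by (simp add: fps_sum_nth fps_X_power_nth if_distrib cong: if_cong)
  have phi: "phi_series (\<Sum>j\<in>J. fps_const (b j) * fps_X ^ j)
      = (\<Sum>j\<in>J. fps_const (phi_fract (b j)) * fps_X ^ (p * j))"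
  proof (rule fps_ext)
    fix n
    have "fps_nth (\<Sum>j\<in>J. fps_const (phi_fract (b j)) * fps_X ^ (p * j)) n
        = (\<Sum>j\<in>J. if n = p * j then phi_fract (b j) else 0)"
      by (simp add: fps_sum_nth fps_X_power_nth if_distrib cong: if_cong)
    also have "\<dots> = (if p dvd n \<and> n div p \<in> J then phi_fract (b (n div p)) else 0)"
    proof (cases "p dvd n")
      case True
      then have "n = p * i \<longleftrightarrow> n div p = i" for i
        using \<open>a < p\<close> by auto
      then show ?thesis using True \<open>finite J\<close> by simp
    qed (auto intro!: sum.neutral)
    finally show "fps_nth (phi_series (\<Sum>j\<in>J. fps_const (b j) * fps_X ^ j)) n
        = fps_nth (\<Sum>j\<in>J. fps_const (phi_fract (b j)) * fps_X ^ (p * j)) n"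
      by (simp add: phi_series_nth coeff p)
  qed
  have less: "a + p * N < p * j \<longleftrightarrow> \<not> j \<le> N" for j
  proof (cases "j \<le> N")
    case True
    then have "p * j \<le> p * N" by (rule mult_le_mono2)
    then have "\<not> a + p * N < p * j" by linarith
    with True show ?thesis by blast
  next
    case False
    then have "p * Suc N \<le> p * j" by (intro mult_le_mono2) simp
    then show ?thesis using False \<open>a < p\<close> by simp
  qed
  have diff: "a + p * N - p * j = a + p * (N - j)" if "j \<le> N" for j
    using that mult_le_mono2[OF that, of p] by (simp add: diff_mult_distrib2)
  have "fps_nth (f * (fps_const c * fps_X ^ (p * j))) (a + p * N)
      = (if j \<le> N then fps_nth f (a + p * (N - j)) * c else 0)" for c j
    by (simp add: mult.left_commute[of f] fps_X_power_mult_right_nth less diff)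
  then show ?thesis
    unfolding phi sum_distrib_left fps_sum_nth by (intro sum.cong) simp_all
qed

text \<open>
  All exponents of \<open>\<phi>(g)\<close> are divisible by \<open>p\<close>, so only those terms of the block with exponent
  \<open>\<equiv> a (mod p)\<close> survive; they come from a block that is shorter by the factor \<open>p\<close>.
\<close>

lemma coeff_phi_series_mult_sum:
  fixes g :: "'p :: prime_card q_field fps"
  assumes p: "p = CARD('p)" and "a < p"
  shows "fps_nth (phi_series g * (\<Sum>j=K * p..<L * p. fps_const (b j) * fps_X ^ j)) (a + p * N)
    = (\<Sum>j=K..<L. if j \<le> N then phi_fract (fps_nth g (N - j)) * b (a + p * j) else 0)"
proof -
  let ?h = "\<lambda>i. if i \<le> a + p * N then fps_nth (phi_series g) (a + p * N - i) * b i else 0"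
  have "fps_nth (phi_series g * (fps_const c * fps_X ^ i)) (a + p * N)
      = (if i \<le> a + p * N then fps_nth (phi_series g) (a + p * N - i) * c else 0)" for c i
    by (simp add: mult.left_commute[of "phi_series g"] fps_X_power_mult_right_nth)
  then have "fps_nth (phi_series g * (\<Sum>j=K * p..<L * p. fps_const (b j) * fps_X ^ j)) (a + p * N)
      = (\<Sum>i=K * p..<L * p. ?h i)"
    unfolding sum_distrib_left fps_sum_nth by (intro sum.cong) simp_all
  also have "\<dots> = (\<Sum>i\<in>(\<lambda>j. a + p * j) ` {K..<L}. ?h i)"
  proof (rule sum.mono_neutral_right)
    show "(\<lambda>j. a + p * j) ` {K..<L} \<subseteq> {K * p..<L * p}"
    proof clarify
      fix j assume "j \<in> {K..<L}"
      then have "K \<le> j" "Suc j \<le> L" by auto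
      then have "K * p \<le> j * p" "Suc j * p \<le> L * p"
        by (simp_all only: mult_le_mono1)
      then have "K * p \<le> a + j * p" "a + j * p < L * p"
        using \<open>a < p\<close> unfolding mult_Suc by linarith+
      then show "a + p * j \<in> {K * p..<L * p}"
        by (simp add: mult.commute)
    qed
    show "\<forall>i\<in>{K * p..<L * p} - (\<lambda>j. a + p * j) ` {K..<L}. ?h i = 0"
    proof
      fix i assume i: "i \<in> {K * p..<L * p} - (\<lambda>j. a + p * j) ` {K..<L}"
      have "\<not> p dvd a + p * N - i" if "i \<le> a + p * N"
      proof
        assume "p dvd a + p * N - i"
        then have "(a + p * N) mod p = i mod p"
          using that by (metis mod_eq_dvd_iff_nat)
        then have "i mod p = a" using \<open>a < p\<close> by simp
        then have "i = a + p * (i div p)" by (metis mod_mult_div_eq)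
        moreover have "i div p \<in> {K..<L}"
          using i \<open>a < p\<close> by (auto simp: less_eq_div_iff_mult_less_eq div_less_iff_less_mult)
        ultimately show False using i by blast
      qed
      then show "?h i = 0" by (simp add: phi_series_nth p)
    qed
  qed simp
  also have "\<dots> = (\<Sum>j=K..<L. ?h (a + p * j))"
    using \<open>a < p\<close> by (subst sum.reindex) (auto simp: inj_on_def)
  also have "\<dots> = (\<Sum>j=K..<L. if j \<le> N then phi_fract (fps_nth g (N - j)) * b (a + p * j) else 0)"
    using \<open>a < p\<close> by (intro sum.cong) (auto simp: phi_series_nth p simp flip: diff_mult_distrib2)
  finally show ?thesis .
qed

lemma R_series_multiples_iff:
  "f \<in> R_series_multiples c \<longleftrightarrow> (\<forall>n. fps_nth f n \<in> R_multiples c)"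
proof
  assume "\<forall>n. fps_nth f n \<in> R_multiples c"
  then have "\<forall>n. \<exists>r. r \<in> R_set \<and> fps_nth f n = c * r"
    by (auto simp: R_multiples_def)
  then obtain r where "\<And>n. r n \<in> R_set" "\<And>n. fps_nth f n = c * r n"
    by metis
  then have "f = fps_const c * Abs_fps r" "Abs_fps r \<in> R_series"
    by (auto simp: fps_eq_iff R_series_def)
  then show "f \<in> R_series_multiples c"
    unfolding R_series_multiples_def by (rule image_eqI)
qed (auto simp: R_series_multiples_def R_series_def R_multiples_def)

section \<open>Dwork's congruence for power series\<close>

theorem theorem7p4:
  fixes B :: "int \<Rightarrow> nat \<Rightarrow> 'p :: prime_card q_field"
    and A :: "nat \<Rightarrow> 'p q_field"
    and p :: nat
    and F G :: "'p q_field fps"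
  assumes p: "p = CARD('p)" "odd p"
    and A: "A = B (-1)"
    and F: "F = Abs_fps A"
    and G: "G = Abs_fps (B 0)"
    and nonzero: "\<And>i n. i \<ge> 0 \<Longrightarrow> B i n \<noteq> 0"
    and a: "\<And>i n m s. i \<ge> -1 \<Longrightarrow>
        B i (n + m * p ^ (s + 1)) / phi_fract (B (i + 1) (n div p + m * p ^ s))
          - B i n / phi_fract (B (i + 1) (n div p))
        \<in> R_multiples (to_fract (q_int (p ^ (s + 1))))"
    and b: "\<And>i n. i \<ge> -1 \<Longrightarrow> B i n / phi_fract (B (i + 1) (n div p)) \<in> R_set"
    and c: "\<And>i n. i \<ge> -1 \<Longrightarrow> B i n \<in> R_set"
    and d: "\<And>i. i \<ge> -1 \<Longrightarrow> B i 0 \<in> R_units"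
  shows "\<And>m s. F * phi_series (\<Sum>j = m * p ^ s..(m + 1) * p ^ s - 1. fps_const (B 0 j) * fps_X ^ j)
          - phi_series G * (\<Sum>j = m * p ^ (s + 1)..(m + 1) * p ^ (s + 1) - 1. fps_const (A j) * fps_X ^ j)
        \<in> R_series_multiples
            (to_fract (q_int (p ^ (s + 1))) * (phi_fract ^^ (s + 1)) (B (int s) m))"
proof -
  fix m s
  define W where "W t n = (phi_fract ^^ t) (B (int t - 1) n)" for t n
  define modulus :: "nat \<Rightarrow> nat \<Rightarrow> 'p q_field"
    where "modulus t s = (phi_fract ^^ t) (to_fract (q_int (p ^ s)))" for t s
  have p_pos: "0 < p"
    using \<open>odd p\<close> by (rule odd_pos)
  \<comment> \<open>The hypotheses on \<open>B\<^sup>(\<^sup>i\<^sup>)\<close> are used for \<open>i = t - 1\<close>, after applying \<open>\<phi>\<^sup>t\<close>.\<close>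
  have ratio: "W t n / W (Suc t) k = (phi_fract ^^ t) (B (int t - 1) n / phi_fract (B (int t - 1 + 1) k))"
    for t n k
    by (simp add: W_def phi_fract_funpow funpow_swap1)
  interpret dwork_system R_set p W modulus
  proof
    fix t n m s
    show "W (Suc t) n \<noteq> 0"
      using nonzero[of "int t" n] by (simp add: W_def phi_fract_funpow phi_fract_eq_0_iff del: funpow.simps)
    show "W t n \<in> R_set"
      unfolding W_def by (intro R_set_funpow c) simp
    show "inverse (W t 0) \<in> R_set"
      unfolding W_def phi_fract_funpow(4)[symmetric] by (intro R_set_funpow R_units_inverse d) simp
    show "W t n / W (Suc t) (n div p) \<in> R_set"
      unfolding ratio by (intro R_set_funpow b) simp
    show "W t (n + m * p ^ Suc s) / W (Suc t) (n div p + m * p ^ s) - W t n / W (Suc t) (n div p)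
        \<in> (*) (modulus t (Suc s)) ` R_set"
      using R_multiples_funpow[OF a[of "int t - 1" n m s], of t]
      unfolding ratio phi_fract_funpow(2)[symmetric] by (simp add: modulus_def R_multiples_def)
    show "modulus 0 t * modulus t s = modulus 0 (t + s)"
      by (simp add: modulus_def phi_fract_funpow p q_int_prime_power_mult flip: to_fract_mult)
  qed (use p_pos R_set_closed in auto)
  have W_0: "W 0 n = A n" and W_1: "W 1 n = phi_fract (B 0 n)" for n
    by (simp_all add: W_def A)
  have "{k..l - 1} = {k..<l}" if "0 < l" for k l :: nat
    using that by auto
  then have block: "{k..(m + 1) * p ^ r - 1} = {k..<(m + 1) * p ^ r}" for k r
    using p_pos by simp
  let ?S = "\<lambda>f r. \<Sum>j = m * p ^ r..(m + 1) * p ^ r - 1. fps_const (f j) * fps_X ^ j"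
  have coeff: "fps_nth (F * phi_series (?S (B 0) s) - phi_series G * ?S A (s + 1)) (a + p * N)
      = block_sum a N s m" if "a < p" for a N
  proof -
    have long_block: "{m * p ^ (s + 1)..<(m + 1) * p ^ (s + 1)} = {m * p ^ s * p..<(m + 1) * p ^ s * p}"
      by (simp only: power_add power_one_right mult.assoc)
    have "(m + 1) * p ^ s = m * p ^ s + p ^ s"
      by simp
    then have "block_sum a N s m = sum (cross_term a N) {m * p ^ s..<(m + 1) * p ^ s}"
      by (simp only: block_sum_def)
    then show ?thesis
      unfolding block long_block fps_sub_nth coeff_mult_phi_series_sum[OF p(1) that finite_atLeastLessThan]
        coeff_phi_series_mult_sum[OF p(1) that] sum_subtractf[symmetric]
      by (simp only:) (intro sum.cong refl, simp add: cross_term_def W_0 W_1[simplified] F G)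
  qed
  show "F * phi_series (?S (B 0) s) - phi_series G * ?S A (s + 1)
      \<in> R_series_multiples (to_fract (q_int (p ^ (s + 1))) * (phi_fract ^^ (s + 1)) (B (int s) m))"
    unfolding R_series_multiples_iff
  proof
    fix n
    have "n mod p < p" using p_pos by simp
    then have "fps_nth (F * phi_series (?S (B 0) s) - phi_series G * ?S A (s + 1)) n
        = block_sum (n mod p) (n div p) s m"
      using coeff[of "n mod p" "n div p"] by (simp only: mod_mult_div_eq)
    moreover have "block_sum (n mod p) (n div p) s m \<in> multiples (modulus 0 (Suc s) * W (Suc s) m)"
      using \<open>n mod p < p\<close> by (rule block_sum_in_multiples)
    moreover have "modulus 0 (Suc s) * W (Suc s) m
        = to_fract (q_int (p ^ (s + 1))) * (phi_fract ^^ (s + 1)) (B (int s) m)"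
      by (simp add: modulus_def W_def)
    ultimately show "fps_nth (F * phi_series (?S (B 0) s) - phi_series G * ?S A (s + 1)) n
        \<in> R_multiples (to_fract (q_int (p ^ (s + 1))) * (phi_fract ^^ (s + 1)) (B (int s) m))"
      by (simp only: R_multiples_def)
  qed
qed

end
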